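(* Fix density operators $\rho,\sigma$. Then, for all real $s<u$ and $\theta\in[0,1]$, $$\mathsf{F}_{(1-\theta)s+\theta u}^{\mathrm{spec}}(\rho,\sigma)\ \le\ \big(\mathsf{F}_s^{\mathrm{spec}}(\rho,\sigma)\big)^{1-\theta}\,\big(\mathsf{F}_u^{\mathrm{spec}}(\rho,\sigma)\big)^{\theta}.$$ Equivalently, the function $t\mapsto \mathsf{F}_t^{\mathrm{spec}}(\rho,\sigma)$ is log-convex on $\mathbb{R}$ (in particular on $[0,1]$).
   Context: A density operator (density matrix, state) is a positive semidefinite complex $n\times n$ matrix of trace one. For positive definite $A,B$, the matrix geometric mean is $A\sharp B=A^{1/2}(A^{-1/2}BA^{-1/2})^{1/2}A^{1/2}$. The weighted spectral fidelity of density operators $\rho,\sigma$ is $\mathsf{F}_t^{\mathrm{spec}}(\rho,\sigma)=\operatorname{Tr}\big(\rho\,(\rho^{-1}\sharp\sigma)^{2t}\big)$, introduced for $t\in[0,1]$; here the same formula is used for every real $t$. For singular density operators, inverse and fractional powers are interpreted on the support of the corresponding operator. *)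

theory Defs
  imports
    "HOL-Analysis.Convex"
    "Jordan_Normal_Form.Schur_Decomposition"
    "Jordan_Normal_Form.Spectral_Radius"
    "HOL-Library.Extended_Real"
begin

section \<open>Density operators\<close>

definition hermitian_mat :: "complex mat \<Rightarrow> bool" where
  "hermitian_mat A \<longleftrightarrow> square_mat A \<and> mat_adjoint A = A"

definition unitary_mat :: "complex mat \<Rightarrow> bool" where
  "unitary_mat U \<longleftrightarrow> square_mat U \<and> mat_adjoint U * U = 1\<^sub>m (dim_row U)"

definition mat_trace :: "'a::comm_monoid_add mat \<Rightarrow> 'a" where
  "mat_trace A = (\<Sum>i<dim_row A. A $$ (i, i))"

text \<open>The order on \<^typ>\<open>complex\<close> is that of \<^theory>\<open>HOL-Library.Complex_Order\<close>:
  \<open>0 \<le> z\<close> says that \<open>z\<close> is real and nonnegative.\<close>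

definition psd_mat :: "complex mat \<Rightarrow> bool" where
  "psd_mat A \<longleftrightarrow> hermitian_mat A \<and> (\<forall>v\<in>carrier_vec (dim_row A). 0 \<le> (A *\<^sub>v v) \<bullet>c v)"

definition density_operator :: "nat \<Rightarrow> complex mat \<Rightarrow> bool" where
  "density_operator n \<rho> \<longleftrightarrow> \<rho> \<in> carrier_mat n n \<and> psd_mat \<rho> \<and> mat_trace \<rho> = 1"


section \<open>Functional calculus, matrix geometric mean and spectral fidelity\<close>

definition unitary_conj_diag :: "complex mat \<Rightarrow> (nat \<Rightarrow> real) \<Rightarrow> complex mat" where
  "unitary_conj_diag U d = U * mat_diag (dim_row U) (\<lambda>i. complex_of_real (d i)) * mat_adjoint U"

text \<open>\<open>f(A) = U diag(f(d)) U\<^sup>*\<close> for any unitary diagonalisation \<open>A = U diag(d) U\<^sup>*\<close> of a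
  Hermitian matrix; see \<open>mat_fun_eq\<close> and \<open>hermitian_spectral\<close> below for well-definedness.\<close>

definition mat_fun :: "(real \<Rightarrow> real) \<Rightarrow> complex mat \<Rightarrow> complex mat" where
  "mat_fun f A = (THE B. \<exists>U d. unitary_mat U \<and> A = unitary_conj_diag U d
                              \<and> B = unitary_conj_diag U (f \<circ> d))"

text \<open>Real powers of a positive semidefinite matrix, taken on its support: since
  \<open>0 powr r = 0\<close> for every \<open>r\<close> (also for \<open>r \<le> 0\<close>), the kernel of \<open>A\<close> is sent to \<open>0\<close>.
  In particular the power \<open>-1\<close> is the inverse on the support (the true inverse for
  invertible \<open>A\<close>), and the power \<open>0\<close> is the projection onto the support.\<close>

definition mat_rpow :: "complex mat \<Rightarrow> real \<Rightarrow> complex mat" where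
  "mat_rpow A r = mat_fun (\<lambda>x. x powr r) A"

definition geo_mean :: "complex mat \<Rightarrow> complex mat \<Rightarrow> complex mat" where
  "geo_mean A B = mat_rpow A (1/2) *
     mat_rpow (mat_rpow A (-1/2) * B * mat_rpow A (-1/2)) (1/2) * mat_rpow A (1/2)"

text \<open>The trace is a real number for density operators (\<open>spec_fidelity_real\<close> below), so
  taking the real part only changes its type.\<close>

definition spec_fidelity :: "real \<Rightarrow> complex mat \<Rightarrow> complex mat \<Rightarrow> real" where
  "spec_fidelity t \<rho> \<sigma> = Re (mat_trace (\<rho> * mat_rpow (geo_mean (mat_rpow \<rho> (-1)) \<sigma>) (2 * t)))"


section \<open>Log-convexity\<close>

text \<open>Convexity of \<open>log f\<close> for \<open>f \<ge> 0\<close>, with \<open>log 0 = -\<infinity>\<close>, so that the identically zero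
  function (which occurs for orthogonal states) is log-convex. In \<^typ>\<open>ereal\<close> one has
  \<open>0 * (-\<infinity>) = 0\<close>, and \<open>+\<infinity>\<close> never occurs below.\<close>

definition eln :: "real \<Rightarrow> ereal" where
  "eln x = (if x = 0 then -\<infinity> else ereal (ln x))"

definition log_convex_on :: "real set \<Rightarrow> (real \<Rightarrow> real) \<Rightarrow> bool" where
  "log_convex_on S f \<longleftrightarrow> convex S \<and> (\<forall>x\<in>S. 0 \<le> f x) \<and>
     (\<forall>x\<in>S. \<forall>y\<in>S. \<forall>\<theta>\<in>{0..1}.
        eln (f ((1 - \<theta>) * x + \<theta> * y)) \<le> ereal (1 - \<theta>) * eln (f x) + ereal \<theta> * eln (f y))"


section \<open>Well-definedness\<close>

lemma adjoint_carrier [simp]: "A \<in> carrier_mat n m \<Longrightarrow> mat_adjoint A \<in> carrier_mat m n"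
  by (auto simp: mat_adjoint_def mat_of_rows_def)

lemma adjoint_dims [simp]:
  "dim_row (mat_adjoint A) = dim_col A" "dim_col (mat_adjoint A) = dim_row A"
  by (auto simp: mat_adjoint_def mat_of_rows_def)

lemma adjoint_index [simp]:
  fixes A :: "complex mat"
  assumes "i < dim_col A" "j < dim_row A"
  shows "mat_adjoint A $$ (i, j) = cnj (A $$ (j, i))"
  using assms by (auto simp: mat_adjoint_def mat_of_rows_def)

lemma adjoint_adjoint [simp]: "mat_adjoint (mat_adjoint A) = (A :: complex mat)"
  by (rule eq_matI) auto

lemma adjoint_mult:
  fixes A B :: "complex mat"
  assumes "A \<in> carrier_mat n m" "B \<in> carrier_mat m k"
  shows "mat_adjoint (A * B) = mat_adjoint B * mat_adjoint A"
  using assms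
  by (intro eq_matI) (auto simp: scalar_prod_def mult.commute intro!: sum.cong)

lemma adjoint_diag [simp]:
  "mat_adjoint (mat_diag n (\<lambda>i. complex_of_real (d i))) = mat_diag n (\<lambda>i. complex_of_real (d i))"
  by (rule eq_matI) (auto simp: mat_diag_def)

lemma unitary_matD:
  assumes "unitary_mat U" "U \<in> carrier_mat n n"
  shows "mat_adjoint U * U = 1\<^sub>m n" "U * mat_adjoint U = 1\<^sub>m n"
proof -
  show *: "mat_adjoint U * U = 1\<^sub>m n" using assms by (auto simp: unitary_mat_def)
  show "U * mat_adjoint U = 1\<^sub>m n"
    by (rule mat_mult_left_right_inverse[OF _ assms(2) *]) (use assms in auto)
qed

lemma unitary_conj_diag_carrier [simp]:
  "U \<in> carrier_mat n n \<Longrightarrow> unitary_conj_diag U d \<in> carrier_mat n n"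
  by (auto simp: unitary_conj_diag_def)

lemma unitary_mat_carrier: "unitary_mat U \<Longrightarrow> U \<in> carrier_mat (dim_row U) (dim_row U)"
  by (auto simp: unitary_mat_def)

lemma unitary_conj_diag_hermitian:
  assumes "U \<in> carrier_mat n n"
  shows "hermitian_mat (unitary_conj_diag U d)"
proof -
  let ?D = "mat_diag n (\<lambda>i. complex_of_real (d i))"
  have U': "mat_adjoint U \<in> carrier_mat n n" using assms by simp
  have "mat_adjoint (U * ?D * mat_adjoint U) = U * mat_adjoint (U * ?D)"
    by (subst adjoint_mult[of _ n n _ n]) (use assms U' in auto)
  also have "mat_adjoint (U * ?D) = ?D * mat_adjoint U"
    by (subst adjoint_mult[of _ n n _ n]) (use assms U' in auto)
  also have "U * (?D * mat_adjoint U) = U * ?D * mat_adjoint U"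
    by (rule assoc_mult_mat[symmetric]) (use assms U' in auto)
  finally show ?thesis
    using assms by (auto simp: hermitian_mat_def unitary_conj_diag_def)
qed

lemma unitary_conj_diag_unique:
  assumes "unitary_mat U" "unitary_mat V" "U \<in> carrier_mat n n" "V \<in> carrier_mat n n"
    and eq: "unitary_conj_diag U d = unitary_conj_diag V e"
  shows "unitary_conj_diag U (f \<circ> d) = unitary_conj_diag V (f \<circ> e)"
proof -
  let ?D = "\<lambda>d. mat_diag n (\<lambda>i. complex_of_real (d i))"
  have c [simp]: "U \<in> carrier_mat n n" "V \<in> carrier_mat n n"
    "mat_adjoint U \<in> carrier_mat n n" "mat_adjoint V \<in> carrier_mat n n"
    "\<And>f. mat_diag n f \<in> carrier_mat n n"
    using assms by auto
  note as = assoc_mult_mat[of _ n n _ n _ n] mult_carrier_mat[of _ n n _ n]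
    left_mult_one_mat[of _ n n] right_mult_one_mat[of _ n n]
  define W where "W = mat_adjoint V * U"
  have W [simp]: "W \<in> carrier_mat n n" unfolding W_def by (rule mult_carrier_mat[of _ n n]) auto
  have VW: "V * W = U"
  proof -
    have "V * W = V * mat_adjoint V * U"
      unfolding W_def by (rule as(1)[symmetric]) auto
    then show ?thesis by (simp add: unitary_matD(2)[OF assms(2,4)] as)
  qed
  have WU: "W * mat_adjoint U = mat_adjoint V"
    unfolding W_def by (simp add: as unitary_matD(2)[OF assms(1,3)])
  have 1: "mat_adjoint V * unitary_conj_diag U d * U = W * ?D d" for d
  proof -
    have "mat_adjoint V * (U * ?D d * mat_adjoint U) * U = W * ?D d * (mat_adjoint U * U)"
      unfolding W_def by (simp add: as)
    then show ?thesis
      by (simp add: unitary_matD(1)[OF assms(1,3)] unitary_conj_diag_def as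
          carrier_matD(1)[OF assms(3)])
  qed
  have 2: "mat_adjoint V * unitary_conj_diag V e * U = ?D e * W" for e
  proof -
    have "mat_adjoint V * (V * ?D e * mat_adjoint V) * U = (mat_adjoint V * V) * (?D e * W)"
      unfolding W_def by (simp add: as)
    then show ?thesis
      by (simp add: unitary_matD(1)[OF assms(2,4)] unitary_conj_diag_def as
          carrier_matD(1)[OF assms(4)])
  qed
  have comm: "W * ?D d = ?D e * W" using 1[of d] 2[of e] eq by simp
  have entry: "W $$ (i, j) * complex_of_real (d j) = complex_of_real (e i) * W $$ (i, j)"
    if "i < n" "j < n" for i j
    using arg_cong[OF comm, of "\<lambda>M. M $$ (i, j)"] that
    by (simp add: mat_diag_mult_left[OF W] mat_diag_mult_right[OF W])
  have comm_f: "W * ?D (f \<circ> d) = ?D (f \<circ> e) * W"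
  proof (rule eq_matI)
    fix i j assume "i < dim_row (?D (f \<circ> e) * W)" "j < dim_col (?D (f \<circ> e) * W)"
    then have ij: "i < n" "j < n" using W by (auto simp: mat_diag_def)
    have "W $$ (i, j) = 0 \<or> d j = e i" using entry[OF ij] by auto
    then show "(W * ?D (f \<circ> d)) $$ (i, j) = (?D (f \<circ> e) * W) $$ (i, j)"
      using ij by (auto simp: mat_diag_mult_left[OF W] mat_diag_mult_right[OF W])
  qed (use carrier_matD[OF W] in \<open>simp_all add: mat_diag_def\<close>)
  have "unitary_conj_diag U (f \<circ> d) = V * (W * ?D (f \<circ> d)) * mat_adjoint U"
  proof -
    have "V * (W * ?D (f \<circ> d)) = V * W * ?D (f \<circ> d)"
      by (rule as(1)[symmetric]) auto
    then show ?thesis by (simp add: VW unitary_conj_diag_def carrier_matD(1)[OF assms(3)])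
  qed
  also have "\<dots> = V * ?D (f \<circ> e) * (W * mat_adjoint U)"
    unfolding comm_f by (simp add: as)
  also have "\<dots> = unitary_conj_diag V (f \<circ> e)"
    unfolding WU by (simp add: unitary_conj_diag_def carrier_matD(1)[OF assms(4)])
  finally show ?thesis .
qed

lemma mat_fun_eq:
  assumes "unitary_mat U"
  shows "mat_fun f (unitary_conj_diag U d) = unitary_conj_diag U (f \<circ> d)"
  unfolding mat_fun_def
proof (rule the_equality)
  fix B assume "\<exists>V e. unitary_mat V \<and> unitary_conj_diag U d = unitary_conj_diag V e
                   \<and> B = unitary_conj_diag V (f \<circ> e)"
  then obtain V e where V: "unitary_mat V" "unitary_conj_diag U d = unitary_conj_diag V e"
    "B = unitary_conj_diag V (f \<circ> e)" by blast
  have dim: "dim_row U = dim_row V"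
    using arg_cong[OF V(2), of dim_row] by (simp only: unitary_conj_diag_def index_mult_mat)
  note c = unitary_mat_carrier[OF assms] unitary_mat_carrier[OF V(1), folded dim]
  show "B = unitary_conj_diag U (f \<circ> d)"
    unfolding V(3) by (rule unitary_conj_diag_unique[OF assms V(1) c V(2), symmetric])
qed (use assms in blast)

lemma orthonormal_eigen_completion:
  fixes A :: "complex mat"
  assumes A: "A \<in> carrier_mat n n" and n: "n > 0"
  obtains U e where "U \<in> carrier_mat n n" "unitary_mat U" "A *\<^sub>v col U 0 = e \<cdot>\<^sub>v col U 0"
proof -
  from spectrum_non_empty[OF A n] obtain e v where ev: "eigenvector A v e"
    by (auto simp: spectrum_def eigenvalue_def)
  then have v: "v \<in> carrier_vec n" "v \<noteq> 0\<^sub>v n" "A *\<^sub>v v = e \<cdot>\<^sub>v v"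
    using A by (auto simp: eigenvector_def)
  interpret cof_vec_space n "TYPE(complex)" .
  define b where "b = basis_completion v"
  note bc = basis_completion[OF v(1,2), folded b_def]
  define ws where "ws = gram_schmidt n b"
  from gram_schmidt_result[OF bc(2,4,5) ws_def]
  have ws: "corthogonal ws" "set ws \<subseteq> carrier_vec n" "length ws = n" using bc(6) by auto
  from bc(6,7) n obtain vs where "b = v # vs" by (cases b) auto
  with gram_schmidt_hd[OF v(1), of vs] have "hd ws = v" by (simp add: ws_def)
  then have ws0: "ws ! 0 = v" using ws(3) n by (cases ws) auto
  have wsc: "ws ! i \<in> carrier_vec n" if "i < n" for i
    using ws(2,3) that by auto
  define N where "N i = sqrt (Re (ws ! i \<bullet>c ws ! i))" for i
  have sq: "ws ! i \<bullet>c ws ! i = complex_of_real (N i * N i)" and Npos: "N i > 0" if "i < n" for i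
  proof -
    have "ws ! i \<bullet>c ws ! i \<noteq> 0"
      using ws that unfolding corthogonal_def by auto
    moreover have "0 \<le> ws ! i \<bullet>c ws ! i" by (rule conjugate_square_ge_0_vec)
    ultimately have *: "Re (ws ! i \<bullet>c ws ! i) > 0" "Im (ws ! i \<bullet>c ws ! i) = 0"
      by (auto simp: less_eq_complex_def complex_eq_iff less_le)
    then show "N i > 0" by (simp add: N_def)
    show "ws ! i \<bullet>c ws ! i = complex_of_real (N i * N i)"
      using * by (simp add: N_def complex_eq_iff)
  qed
  define U where "U = mat n n (\<lambda>(i, j). ws ! j $ i / complex_of_real (N j))"
  have U: "U \<in> carrier_mat n n" by (simp add: U_def)
  have "mat_adjoint U * U = 1\<^sub>m n"
  proof (rule eq_matI)
    fix i j assume "i < dim_row (1\<^sub>m n :: complex mat)" "j < dim_col (1\<^sub>m n :: complex mat)"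
    then have ij: "i < n" "j < n" by auto
    have "(mat_adjoint U * U) $$ (i, j) =
      (\<Sum>k<n. cnj (ws ! i $ k) * ws ! j $ k) / (complex_of_real (N i) * complex_of_real (N j))"
      using ij by (simp add: U_def scalar_prod_def sum_divide_distrib atLeast0LessThan)
    also have "(\<Sum>k<n. cnj (ws ! i $ k) * ws ! j $ k) = ws ! j \<bullet>c ws ! i"
      using wsc[OF ij(1)] by (simp add: scalar_prod_def atLeast0LessThan mult.commute)
    also have "(ws ! j \<bullet>c ws ! i) / (complex_of_real (N i) * complex_of_real (N j))
      = (if i = j then 1 else 0)"
    proof (cases "i = j")
      case True
      then show ?thesis using sq[OF ij(1)] Npos[OF ij(1)] by simp
    next
      case False
      then have "ws ! j \<bullet>c ws ! i = 0" using ws ij unfolding corthogonal_def by auto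
      then show ?thesis using False by simp
    qed
    finally show "(mat_adjoint U * U) $$ (i, j) = 1\<^sub>m n $$ (i, j)" using ij by simp
  qed (auto simp: U_def)
  then have "unitary_mat U" using U by (simp add: unitary_mat_def)
  moreover have "col U 0 = (1 / complex_of_real (N 0)) \<cdot>\<^sub>v v"
    using n v(1) ws0 by (intro eq_vecI) (auto simp: U_def)
  then have "A *\<^sub>v col U 0 = e \<cdot>\<^sub>v col U 0"
    using A v by (simp add: mult_mat_vec smult_smult_assoc mult.commute)
  ultimately show ?thesis using that U by blast
qed

theorem hermitian_spectral:
  assumes "hermitian_mat A" "A \<in> carrier_mat n n"
  shows "\<exists>U d. U \<in> carrier_mat n n \<and> unitary_mat U \<and> A = unitary_conj_diag U d"
  using assms
proof (induction n arbitrary: A)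
  case 0
  then show ?case
    by (intro exI[of _ "1\<^sub>m 0"] exI[of _ "\<lambda>_. 0"])
       (auto simp: unitary_mat_def unitary_conj_diag_def intro!: eq_matI)
next
  case (Suc n)
  let ?N = "Suc n"
  have A [simp]: "A \<in> carrier_mat ?N ?N" and hA: "mat_adjoint A = A"
    using Suc.prems by (auto simp: hermitian_mat_def)
  obtain U e where U [simp]: "U \<in> carrier_mat ?N ?N" and uU: "unitary_mat U"
    and eU: "A *\<^sub>v col U 0 = e \<cdot>\<^sub>v col U 0"
    using orthonormal_eigen_completion[OF A] by auto
  have U' [simp]: "mat_adjoint U \<in> carrier_mat ?N ?N" by simp
  note as = assoc_mult_mat[of _ ?N ?N _ ?N _ ?N] mult_carrier_mat[of _ ?N ?N _ ?N]
    left_mult_one_mat[of _ ?N ?N] right_mult_one_mat[of _ ?N ?N]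
  define A' where "A' = mat_adjoint U * A * U"
  have A' [simp]: "A' \<in> carrier_mat ?N ?N"
    unfolding A'_def by (intro mult_carrier_mat[of _ ?N ?N]) auto
  have hA': "mat_adjoint A' = A'"
  proof -
    have "mat_adjoint (mat_adjoint U * A * U) = mat_adjoint U * mat_adjoint (mat_adjoint U * A)"
      by (rule adjoint_mult[of _ ?N ?N _ ?N]) (auto intro!: as(2))
    also have "mat_adjoint (mat_adjoint U * A) = A * U"
      by (subst adjoint_mult[of _ ?N ?N _ ?N]) (auto simp: hA)
    finally show ?thesis by (simp add: A'_def as)
  qed
  have AU: "A = U * A' * mat_adjoint U"
  proof -
    have "U * A' * mat_adjoint U = (U * mat_adjoint U) * A * (U * mat_adjoint U)"
      by (simp add: A'_def as)
    also have "\<dots> = A" unfolding unitary_matD[OF uU U] by (simp add: as)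
    finally show ?thesis ..
  qed
  have A'0: "A' $$ (i, 0) = (if i = 0 then e else 0)" if "i < ?N" for i
  proof -
    have "A' $$ (i, 0) = row (mat_adjoint U) i \<bullet> col (A * U) 0"
      using that carrier_matD[OF A] carrier_matD[OF U] by (simp add: A'_def as)
    also have "col (A * U) 0 = e \<cdot>\<^sub>v col U 0"
      using eU by (simp add: col_mult2[of _ ?N ?N _ ?N])
    also have "row (mat_adjoint U) i \<bullet> (e \<cdot>\<^sub>v col U 0) = e * (row (mat_adjoint U) i \<bullet> col U 0)"
      by (rule scalar_prod_smult_distrib[of _ ?N]) (use that carrier_matD[OF U] in \<open>auto intro!: carrier_vecI\<close>)
    also have "row (mat_adjoint U) i \<bullet> col U 0 = (mat_adjoint U * U) $$ (i, 0)"
      using that carrier_matD[OF U] by simp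
    also have "\<dots> = (if i = 0 then 1 else 0)"
      using that by (simp add: unitary_matD[OF uU U])
    finally show ?thesis by simp
  qed
  have hA'_entry: "A' $$ (i, j) = cnj (A' $$ (j, i))" if "i < ?N" "j < ?N" for i j
    using arg_cong[OF hA', of "\<lambda>M. M $$ (i, j)"] that carrier_matD[OF A'] by simp
  have e_real: "e = complex_of_real (Re e)"
    using hA'_entry[of 0 0] A'0[of 0] by (simp add: complex_eq_iff)
  have A'0r: "A' $$ (0, j) = (if j = 0 then e else 0)" if "j < ?N" for j
    using hA'_entry[of 0 j] A'0[of j] A'0[of 0] that by auto
  define A3 where "A3 = mat n n (\<lambda>(i, j). A' $$ (Suc i, Suc j))"
  have A3 [simp]: "A3 \<in> carrier_mat n n" by (simp add: A3_def)
  have "mat_adjoint A3 = A3"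
    by (rule eq_matI) (auto simp: A3_def hA'_entry[symmetric])
  then have "hermitian_mat A3" by (simp add: hermitian_mat_def A3_def)
  from Suc.IH[OF this A3] obtain V d where V [simp]: "V \<in> carrier_mat n n"
    and uV: "unitary_mat V" and A3V: "A3 = unitary_conj_diag V d" by blast
  have V' [simp]: "mat_adjoint V \<in> carrier_mat n n" by simp
  let ?z1 = "0\<^sub>m 1 n :: complex mat" and ?z2 = "0\<^sub>m n 1 :: complex mat"
  define E where "E = mat 1 1 (\<lambda>_. e)"
  define D where "D = mat_diag n (\<lambda>i. complex_of_real (d i))"
  define d' where "d' i = (case i of 0 \<Rightarrow> Re e | Suc k \<Rightarrow> d k)" for i
  define D' where "D' = mat_diag ?N (\<lambda>i. complex_of_real (d' i))"
  define P where "P = four_block_mat (1\<^sub>m 1) ?z1 ?z2 V"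
  define P' where "P' = four_block_mat (1\<^sub>m 1) ?z1 ?z2 (mat_adjoint V)"
  have E [simp]: "E \<in> carrier_mat 1 1" and D [simp]: "D \<in> carrier_mat n n"
    and D' [simp]: "D' \<in> carrier_mat ?N ?N"
    by (auto simp: E_def D_def D'_def)
  have P [simp]: "P \<in> carrier_mat ?N ?N" and P' [simp]: "P' \<in> carrier_mat ?N ?N"
    using four_block_carrier_mat[of "1\<^sub>m 1" 1 1 V n n]
      four_block_carrier_mat[of "1\<^sub>m 1" 1 1 "mat_adjoint V" n n]
    by (auto simp: P_def P'_def)
  have adjP: "mat_adjoint P = P'"
    using carrier_matD[OF V]
    by (intro eq_matI) (auto simp: P_def P'_def)
  have D'_block: "D' = four_block_mat E ?z1 ?z2 D"
    using e_real
    by (intro eq_matI) (auto simp: D'_def D_def E_def mat_diag_def d'_def split: nat.splits)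
  have A'_block: "A' = four_block_mat E ?z1 ?z2 A3"
    using carrier_matD[OF A'] A'0 A'0r
    by (intro eq_matI) (auto simp: E_def A3_def)
  note z = left_mult_zero_mat[OF V] left_mult_zero_mat[OF V']
    right_mult_zero_mat[OF V] right_mult_zero_mat[OF V']
    left_mult_zero_mat[OF D] right_mult_zero_mat[OF D]
    left_mult_zero_mat[OF E] right_mult_zero_mat[OF E]
  have "P' * P = four_block_mat (1\<^sub>m 1) ?z1 ?z2 (1\<^sub>m n)"
    unfolding P_def P'_def
    by (subst mult_four_block_mat[of _ 1 1 _ n _ n _ _ 1 _ n])
       (auto simp: unitary_matD[OF uV V] z)
  also have "\<dots> = 1\<^sub>m ?N" by (intro eq_matI) auto
  finally have P'P: "P' * P = 1\<^sub>m ?N" .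
  have "P * D' * P' = four_block_mat E ?z1 ?z2 (V * D * mat_adjoint V)"
    unfolding P_def P'_def D'_block
    using mult_carrier_mat[OF V D]
    by (simp add: mult_four_block_mat[of _ 1 1 _ n _ n _ _ 1 _ n] z
        left_mult_one_mat[of _ 1 1] right_mult_one_mat[of _ 1 1]
        right_mult_zero_mat[of _ n n] left_mult_zero_mat[of _ n n]
        del: assoc_mult_mat One_nat_def)
  then have A'P: "A' = P * D' * P'"
    using carrier_matD[OF V] by (simp add: A'_block A3V unitary_conj_diag_def D_def)
  have UP [simp]: "U * P \<in> carrier_mat ?N ?N" by (rule mult_carrier_mat[of _ ?N ?N]) auto
  have adjUP: "mat_adjoint (U * P) = P' * mat_adjoint U"
    by (subst adjoint_mult[of _ ?N ?N _ ?N]) (auto simp: adjP)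
  have "mat_adjoint (U * P) * (U * P) = P' * (mat_adjoint U * U) * P"
    unfolding adjUP by (simp add: as)
  then have "unitary_mat (U * P)"
    using carrier_matD[OF U] carrier_matD[OF P]
    by (simp add: unitary_mat_def unitary_matD[OF uU U] P'P as)
  moreover have "A = unitary_conj_diag (U * P) d'"
    using carrier_matD[OF U]
    unfolding AU A'P unitary_conj_diag_def adjUP by (simp add: as D'_def[symmetric])
  ultimately show ?case using UP by blast
qed

lemma hermitian_mat_cases:
  assumes "hermitian_mat A" "A \<in> carrier_mat n n"
  obtains U d where "U \<in> carrier_mat n n" "unitary_mat U" "A = unitary_conj_diag U d"
    "\<And>f. mat_fun f A = unitary_conj_diag U (f \<circ> d)"
  using hermitian_spectral[OF assms] mat_fun_eq by metis

lemma mat_fun_carrier_hermitian: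
  assumes "hermitian_mat A" "A \<in> carrier_mat n n"
  shows "mat_fun f A \<in> carrier_mat n n" "hermitian_mat (mat_fun f A)"
  using hermitian_mat_cases[OF assms] unitary_conj_diag_carrier unitary_conj_diag_hermitian
  by metis+

lemma unitary_conj_diag_mult:
  assumes "U \<in> carrier_mat n n" "unitary_mat U"
  shows "unitary_conj_diag U d * unitary_conj_diag U e = unitary_conj_diag U (\<lambda>i. d i * e i)"
proof -
  let ?D = "\<lambda>d. mat_diag n (\<lambda>i. complex_of_real (d i))"
  note as = assoc_mult_mat[of _ n n _ n _ n] mult_carrier_mat[of _ n n _ n]
    left_mult_one_mat[of _ n n] right_mult_one_mat[of _ n n]
  have c [simp]: "U \<in> carrier_mat n n" "mat_adjoint U \<in> carrier_mat n n"
    using assms by auto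
  have "unitary_conj_diag U d * unitary_conj_diag U e
      = U * ?D d * (mat_adjoint U * U) * (?D e * mat_adjoint U)"
    by (simp add: unitary_conj_diag_def carrier_matD(1)[OF assms(1)] as)
  also have "\<dots> = U * (?D d * ?D e) * mat_adjoint U"
    unfolding unitary_matD[OF assms(2,1)] by (simp add: as del: mat_diag_diag)
  finally show ?thesis by (simp add: unitary_conj_diag_def carrier_matD(1)[OF assms(1)])
qed

lemma psd_eigenvalues_nonneg:
  assumes "U \<in> carrier_mat n n" "unitary_mat U" "psd_mat (unitary_conj_diag U d)" "i < n"
  shows "0 \<le> d i"
proof -
  let ?A = "unitary_conj_diag U d" and ?D = "mat_diag n (\<lambda>i. complex_of_real (d i))"
  note as = assoc_mult_mat[of _ n n _ n _ n] mult_carrier_mat[of _ n n _ n]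
    left_mult_one_mat[of _ n n] right_mult_one_mat[of _ n n]
  have c [simp]: "U \<in> carrier_mat n n" "mat_adjoint U \<in> carrier_mat n n"
    using assms by auto
  have "?A * U = U * ?D * (mat_adjoint U * U)"
    by (simp add: unitary_conj_diag_def carrier_matD(1)[OF assms(1)] as)
  then have AU: "?A * U = U * ?D" by (simp add: unitary_matD[OF assms(2,1)] as)
  have col: "?A *\<^sub>v col U i = complex_of_real (d i) \<cdot>\<^sub>v col U i"
  proof -
    have "?A *\<^sub>v col U i = col (?A * U) i"
      by (rule col_mult2[symmetric, of _ n n _ n]) (use assms in auto)
    then show ?thesis
      unfolding AU mat_diag_mult_right[OF c(1)] using carrier_matD[OF c(1)] assms(4)
      by (auto simp: mult.commute intro!: eq_vecI)
  qed
  have "col U i \<bullet>c col U i = (mat_adjoint U * U) $$ (i, i)"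
    using carrier_matD[OF c(1)] assms(4) by (simp add: scalar_prod_def mult.commute)
  also have "\<dots> = 1" using assms(4) by (simp add: unitary_matD[OF assms(2,1)])
  finally have nrm: "col U i \<bullet>c col U i = 1" .
  have "0 \<le> (?A *\<^sub>v col U i) \<bullet>c col U i"
  proof -
    have "col U i \<in> carrier_vec (dim_row ?A)"
      unfolding carrier_matD(1)[OF unitary_conj_diag_carrier[OF c(1)]]
      by (rule col_carrier_vec[OF _ c(1)]) (rule assms(4))
    then show ?thesis using assms(3) unfolding psd_mat_def by blast
  qed
  also have "\<dots> = complex_of_real (d i)"
    unfolding col using assms(1,4) nrm by (subst smult_scalar_prod_distrib[of _ n]) auto
  finally show ?thesis by (simp add: less_eq_complex_def)
qed

lemma psd_mat_cases:
  assumes "psd_mat A" "A \<in> carrier_mat n n"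
  obtains U d where "U \<in> carrier_mat n n" "unitary_mat U" "A = unitary_conj_diag U d"
    "\<And>i. i < n \<Longrightarrow> 0 \<le> d i" "\<And>r. mat_rpow A r = unitary_conj_diag U (\<lambda>i. d i powr r)"
proof -
  from assms have "hermitian_mat A" by (simp add: psd_mat_def)
  from hermitian_mat_cases[OF this assms(2)] obtain U d where
    *: "U \<in> carrier_mat n n" "unitary_mat U" "A = unitary_conj_diag U d"
    "\<And>f. mat_fun f A = unitary_conj_diag U (f \<circ> d)" by metis
  show ?thesis
    by (rule that[OF *(1-3)])
       (use psd_eigenvalues_nonneg[OF *(1,2)] assms * in \<open>auto simp: mat_rpow_def o_def\<close>)
qed

lemma unitary_conj_diag_cong:
  assumes "U \<in> carrier_mat n n" "\<And>i. i < n \<Longrightarrow> d i = e i"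
  shows "unitary_conj_diag U d = unitary_conj_diag U e"
proof -
  have "mat_diag n (\<lambda>i. complex_of_real (d i)) = mat_diag n (\<lambda>i. complex_of_real (e i))"
    using assms(2) by (intro eq_matI) (auto simp: mat_diag_def)
  then show ?thesis using assms(1) by (simp add: unitary_conj_diag_def)
qed

lemma mat_rpow_add:
  assumes "psd_mat A" "A \<in> carrier_mat n n"
  shows "mat_rpow A r * mat_rpow A s = mat_rpow A (r + s)"
proof -
  obtain U d where *: "U \<in> carrier_mat n n" "unitary_mat U"
    "\<And>r. mat_rpow A r = unitary_conj_diag U (\<lambda>i. d i powr r)"
    using psd_mat_cases[OF assms] by metis
  show ?thesis unfolding *(3) unitary_conj_diag_mult[OF *(1,2)] by (simp add: powr_add)
qed

lemma mat_rpow_one: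
  assumes "psd_mat A" "A \<in> carrier_mat n n"
  shows "mat_rpow A 1 = A"
proof -
  obtain U d where *: "U \<in> carrier_mat n n" "unitary_mat U" "A = unitary_conj_diag U d"
    "\<And>i. i < n \<Longrightarrow> 0 \<le> d i" "\<And>r. mat_rpow A r = unitary_conj_diag U (\<lambda>i. d i powr r)"
    using psd_mat_cases[OF assms] by metis
  have "mat_rpow A 1 = unitary_conj_diag U d"
    unfolding *(5) using *(4) by (intro unitary_conj_diag_cong[OF *(1)]) auto
  then show ?thesis unfolding *(3) .
qed

lemma mat_rpow_minus_one:
  assumes "psd_mat A" "A \<in> carrier_mat n n" "invertible_mat A"
  shows "A * mat_rpow A (-1) = 1\<^sub>m n" "mat_rpow A (-1) * A = 1\<^sub>m n"
proof -
  have c: "mat_rpow A r \<in> carrier_mat n n" for r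
    using assms mat_fun_carrier_hermitian unfolding psd_mat_def mat_rpow_def by blast
  obtain B where B: "A * B = 1\<^sub>m (dim_row A)" "B * A = 1\<^sub>m (dim_row B)"
    using assms(3) unfolding invertible_mat_def inverts_mat_def by blast
  have "dim_row B = n" "dim_col B = n"
    using arg_cong[OF B(1), of dim_col] arg_cong[OF B(2), of dim_col] carrier_matD[OF assms(2)]
    by simp_all
  then have Bc: "B \<in> carrier_mat n n" and BA: "B * A = 1\<^sub>m n" using B(2) by auto
  have 1: "A * mat_rpow A 0 = A"
    using mat_rpow_add[OF assms(1,2), of 1 0] by (simp add: mat_rpow_one[OF assms(1,2)])
  have "mat_rpow A 0 = (B * A) * mat_rpow A 0"
    unfolding BA by (rule left_mult_one_mat[OF c, symmetric])
  also have "\<dots> = B * (A * mat_rpow A 0)"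
    by (rule assoc_mult_mat[OF Bc assms(2) c])
  finally have 0: "mat_rpow A 0 = 1\<^sub>m n" unfolding 1 BA .
  have "mat_rpow A 1 * mat_rpow A (-1) = 1\<^sub>m n" "mat_rpow A (-1) * mat_rpow A 1 = 1\<^sub>m n"
    unfolding mat_rpow_add[OF assms(1,2)] by (simp_all add: 0)
  then show "A * mat_rpow A (-1) = 1\<^sub>m n" "mat_rpow A (-1) * A = 1\<^sub>m n"
    unfolding mat_rpow_one[OF assms(1,2)] .
qed

lemma hermitian_sandwich:
  assumes "hermitian_mat X" "hermitian_mat B" "X \<in> carrier_mat n n" "B \<in> carrier_mat n n"
  shows "hermitian_mat (X * B * X)"
proof -
  have "mat_adjoint (X * B * X) = mat_adjoint X * mat_adjoint (X * B)"
    by (rule adjoint_mult[of _ n n _ n]) (use assms in auto)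
  also have "mat_adjoint (X * B) = mat_adjoint B * mat_adjoint X"
    by (rule adjoint_mult[of _ n n _ n]) (use assms in auto)
  finally show ?thesis
    using assms by (simp add: hermitian_mat_def assoc_mult_mat[of _ n n _ n _ n])
qed

lemma mat_trace_hermitian_mult:
  assumes "hermitian_mat A" "hermitian_mat B" "A \<in> carrier_mat n n" "B \<in> carrier_mat n n"
  shows "Im (mat_trace (A * B)) = 0"
proof -
  have h: "cnj (A $$ (i, j)) = A $$ (j, i)" "cnj (B $$ (i, j)) = B $$ (j, i)"
    if "i < n" "j < n" for i j
    using that assms adjoint_index[of j A i] adjoint_index[of j B i]
    by (auto simp: hermitian_mat_def)
  have tr: "mat_trace (A * B) = (\<Sum>i<n. \<Sum>j<n. A $$ (i, j) * B $$ (j, i))"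
    using assms by (auto simp: mat_trace_def scalar_prod_def atLeast0LessThan)
  have "cnj (mat_trace (A * B)) = (\<Sum>i<n. \<Sum>j<n. A $$ (j, i) * B $$ (i, j))"
    unfolding tr by (auto simp: h intro!: sum.cong)
  also have "\<dots> = mat_trace (A * B)" unfolding tr by (rule sum.swap)
  finally show ?thesis by (simp add: complex_eq_iff)
qed

lemma geo_mean_hermitian:
  assumes "hermitian_mat A" "hermitian_mat B" "A \<in> carrier_mat n n" "B \<in> carrier_mat n n"
  shows "hermitian_mat (geo_mean A B)" "geo_mean A B \<in> carrier_mat n n"
proof -
  note mc = mult_carrier_mat[of _ n n _ n]
  have p: "mat_rpow A r \<in> carrier_mat n n" "hermitian_mat (mat_rpow A r)" for r
    using mat_fun_carrier_hermitian[OF assms(1,3)] by (auto simp: mat_rpow_def)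
  let ?M = "mat_rpow A (-1/2) * B * mat_rpow A (-1/2)"
  have M: "hermitian_mat ?M" "?M \<in> carrier_mat n n"
    by (rule hermitian_sandwich[OF p(2) assms(2) p(1) assms(4)])
       (rule mc[OF mc[OF p(1) assms(4)] p(1)])
  have q: "mat_rpow ?M r \<in> carrier_mat n n" "hermitian_mat (mat_rpow ?M r)" for r
    using mat_fun_carrier_hermitian[OF M] by (auto simp: mat_rpow_def)
  show "hermitian_mat (geo_mean A B)"
    unfolding geo_mean_def by (rule hermitian_sandwich[OF p(2) q(2) p(1) q(1)])
  show "geo_mean A B \<in> carrier_mat n n"
    unfolding geo_mean_def by (rule mc[OF mc[OF p(1) q(1)] p(1)])
qed

lemma spec_fidelity_real:
  assumes "density_operator n \<rho>" "density_operator n \<sigma>"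
  shows "complex_of_real (spec_fidelity t \<rho> \<sigma>) =
           mat_trace (\<rho> * mat_rpow (geo_mean (mat_rpow \<rho> (-1)) \<sigma>) (2 * t))"
proof -
  have h: "hermitian_mat \<rho>" "hermitian_mat \<sigma>" "\<rho> \<in> carrier_mat n n" "\<sigma> \<in> carrier_mat n n"
    using assms by (auto simp: density_operator_def psd_mat_def)
  note i = mat_fun_carrier_hermitian[OF h(1,3), of "\<lambda>x. x powr (-1)", folded mat_rpow_def]
  note g = geo_mean_hermitian[OF i(2) h(2) i(1) h(4)]
  note G = mat_fun_carrier_hermitian[OF g, of "\<lambda>x. x powr (2 * t)", folded mat_rpow_def]
  show ?thesis
    using mat_trace_hermitian_mult[OF h(1) G(2) h(3) G(1)]
    by (simp add: spec_fidelity_def complex_eq_iff)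
qed

end

theory Submission
  imports Defs
begin

text \<open>
  Diagonalise the Hermitian matrix \<open>G = \<rho>\<^sup>-\<^sup>1 \<sharp> \<sigma>\<close> as
  \<open>U diag(g) U\<^sup>*\<close> and let \<open>u\<^sub>k\<close> be the columns of \<open>U\<close>. Then
  \<open>Tr (\<rho> G\<^sup>2\<^sup>t) = (\<Sum>k. \<langle>u\<^sub>k, \<rho> u\<^sub>k\<rangle> g\<^sub>k\<^sup>2\<^sup>t)\<close>, where the weights
  \<open>\<langle>u\<^sub>k, \<rho> u\<^sub>k\<rangle>\<close> are nonnegative and do not depend on \<open>t\<close>
  (\<open>spec_fidelity_eq_powr_sum\<close>). So the fidelity is a nonnegative combination of exponential
  functions of \<open>t\<close>. Each of these is log-affine, and Hoelder's inequality, for the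
  conjugate exponents \<open>1 / (1 - \<theta>)\<close> and \<open>1 / \<theta>\<close>, shows that their sum is log-convex
  (\<open>sum_powr_mult_le\<close>, \<open>powr_sum_log_convex\<close>).

  The passage to logarithms relies on \<open>0 powr r = 0\<close> for every \<open>r\<close>, even for \<open>r = 0\<close>: the
  multiplicative inequality makes its left-hand side vanish as soon as one of the endpoint
  values does (\<open>eln_weighted_le\<close>). In return, this convention makes the multiplicative inequality at \<open>\<theta> = 0\<close> and \<open>\<theta> = 1\<close> a
  genuine claim, which holds because the fidelity vanishes for one \<open>t\<close> only if it vanishes for
  all \<open>t\<close>: the terms of the sum that are zero are the same for every \<open>t\<close>.
\<close>

text \<open>Hoelder's inequality, with the endpoints \<open>\<theta> = 0\<close> and \<open>\<theta> = 1\<close> included: sum Young's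
  inequality over \<open>I\<close> after normalising both families to total mass one.\<close>

lemma sum_powr_mult_le:
  fixes a b :: "'i \<Rightarrow> real"
  assumes "finite I" and \<theta>: "0 \<le> \<theta>" "\<theta> \<le> 1"
    and a: "\<And>i. i \<in> I \<Longrightarrow> 0 \<le> a i" and b: "\<And>i. i \<in> I \<Longrightarrow> 0 \<le> b i"
  shows "(\<Sum>i\<in>I. a i powr (1 - \<theta>) * b i powr \<theta>) \<le> sum a I powr (1 - \<theta>) * sum b I powr \<theta>"
proof (cases "sum a I = 0 \<or> sum b I = 0")
  case True
  then have "(\<forall>i\<in>I. a i = 0) \<or> (\<forall>i\<in>I. b i = 0)"
    using \<open>finite I\<close> a b by (simp add: sum_nonneg_eq_0_iff)
  then show ?thesis by auto
next
  case False
  then have A: "0 < sum a I" and B: "0 < sum b I"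
    using sum_nonneg[of I a] sum_nonneg[of I b] a b by (auto simp: less_le)
  let ?C = "sum a I powr (1 - \<theta>) * sum b I powr \<theta>"
  have "(a i powr (1 - \<theta>) * b i powr \<theta>) / ?C \<le> (1 - \<theta>) * (a i / sum a I) + \<theta> * (b i / sum b I)"
    if "i \<in> I" for i
  proof (cases "a i = 0 \<or> b i = 0")
    case True
    then show ?thesis using a[OF that] b[OF that] A B \<theta> by auto
  next
    case False
    then have "0 < a i / sum a I" "0 < b i / sum b I"
      using a[OF that] b[OF that] A B by (auto simp: less_le)
    from Youngs_inequality_0[of "1 - \<theta>" \<theta>, OF _ _ _ this] \<theta> show ?thesis
      using a[OF that] b[OF that] A B by (simp add: powr_divide)
  qed
  then have "(\<Sum>i\<in>I. a i powr (1 - \<theta>) * b i powr \<theta>) / ?C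
      \<le> (\<Sum>i\<in>I. (1 - \<theta>) * (a i / sum a I) + \<theta> * (b i / sum b I))"
    unfolding sum_divide_distrib by (rule sum_mono)
  also have "\<dots> = (1 - \<theta>) * (sum a I / sum a I) + \<theta> * (sum b I / sum b I)"
    by (simp only: sum.distrib sum_distrib_left[symmetric] sum_divide_distrib[symmetric])
  also have "\<dots> = 1" using A B by simp
  finally show ?thesis using A B by (simp add: divide_le_eq)
qed

lemma powr_sum_log_convex:
  fixes c g :: "'i \<Rightarrow> real"
  assumes "finite I" "0 \<le> \<theta>" "\<theta> \<le> 1" and c: "\<And>i. i \<in> I \<Longrightarrow> 0 \<le> c i"
  shows "(\<Sum>i\<in>I. c i * g i powr ((1 - \<theta>) * s + \<theta> * u))
    \<le> (\<Sum>i\<in>I. c i * g i powr s) powr (1 - \<theta>) * (\<Sum>i\<in>I. c i * g i powr u) powr \<theta>"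
proof -
  have "c i * g i powr ((1 - \<theta>) * s + \<theta> * u)
      = (c i * g i powr s) powr (1 - \<theta>) * (c i * g i powr u) powr \<theta>" if "i \<in> I" for i
  proof -
    have "c i = c i powr (1 - \<theta>) * c i powr \<theta>"
      using c[OF that] by (simp flip: powr_add)
    then show ?thesis
      using c[OF that] by (simp add: powr_mult powr_powr powr_add mult_ac)
  qed
  then have "(\<Sum>i\<in>I. c i * g i powr ((1 - \<theta>) * s + \<theta> * u))
      = (\<Sum>i\<in>I. (c i * g i powr s) powr (1 - \<theta>) * (c i * g i powr u) powr \<theta>)"
    by (rule sum.cong[OF refl])
  also have "\<dots> \<le> (\<Sum>i\<in>I. c i * g i powr s) powr (1 - \<theta>) * (\<Sum>i\<in>I. c i * g i powr u) powr \<theta>"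
    by (rule sum_powr_mult_le) (use assms in auto)
  finally show ?thesis .
qed

lemma eln_weighted_le:
  assumes "0 \<le> a" "0 \<le> b" "0 \<le> c" and le: "c \<le> a powr (1 - \<theta>) * b powr \<theta>"
  shows "eln c \<le> ereal (1 - \<theta>) * eln a + ereal \<theta> * eln b"
proof (cases "c = 0")
  case True
  then show ?thesis by (simp add: eln_def)
next
  case False
  \<comment> \<open>\<open>0 powr r = 0\<close> also for \<open>r = 0\<close>, so a zero among \<open>a\<close>, \<open>b\<close> would force \<open>c = 0\<close>.\<close>
  with le \<open>0 \<le> c\<close> have "a \<noteq> 0" "b \<noteq> 0" by auto
  then have pos: "0 < a" "0 < b" "0 < c" using assms False by auto
  have "ln c \<le> ln (a powr (1 - \<theta>) * b powr \<theta>)" using le pos by simp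
  also have "\<dots> = (1 - \<theta>) * ln a + \<theta> * ln b" using pos by (simp add: ln_mult ln_powr)
  finally show ?thesis using pos by (simp add: eln_def)
qed

text \<open>By cyclicity, the trace against \<open>U diag(d) U\<^sup>*\<close> only sees the diagonal of \<open>U\<^sup>* A U\<close>,
  whose entries are the values of the quadratic form of \<open>A\<close> at the columns of \<open>U\<close>.\<close>

lemma mat_trace_mult_unitary_conj_diag:
  assumes A: "A \<in> carrier_mat n n" and U: "U \<in> carrier_mat n n"
  shows "mat_trace (A * unitary_conj_diag U d)
    = (\<Sum>k<n. complex_of_real (d k) * ((A *\<^sub>v col U k) \<bullet>c col U k))"
proof -
  have entry: "unitary_conj_diag U d $$ (j, i)
      = (\<Sum>k<n. U $$ (j, k) * complex_of_real (d k) * cnj (U $$ (i, k)))" if "i < n" "j < n" for i j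
    using that U
    by (simp add: unitary_conj_diag_def mat_diag_mult_right[OF U] scalar_prod_def atLeast0LessThan)
  have "mat_trace (A * unitary_conj_diag U d)
      = (\<Sum>i<n. \<Sum>j<n. A $$ (i, j) * unitary_conj_diag U d $$ (j, i))"
    using A unitary_conj_diag_carrier[OF U, of d]
    by (simp add: mat_trace_def scalar_prod_def atLeast0LessThan)
  also have "\<dots> = (\<Sum>i<n. \<Sum>j<n. \<Sum>k<n.
      A $$ (i, j) * (U $$ (j, k) * complex_of_real (d k) * cnj (U $$ (i, k))))"
    by (simp add: entry sum_distrib_left)
  also have "\<dots> = (\<Sum>k<n. \<Sum>i<n. \<Sum>j<n.
      A $$ (i, j) * (U $$ (j, k) * complex_of_real (d k) * cnj (U $$ (i, k))))"
    by (subst sum.swap[of _ "{..<n}" "{..<n}"], subst sum.swap) (rule refl)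
  also have "\<dots> = (\<Sum>k<n. complex_of_real (d k) * ((A *\<^sub>v col U k) \<bullet>c col U k))"
    using A U
    by (auto simp: scalar_prod_def atLeast0LessThan sum_distrib_left sum_distrib_right mult_ac
        intro!: sum.cong)
  finally show ?thesis .
qed

lemma spec_fidelity_eq_powr_sum:
  assumes \<rho>: "density_operator n \<rho>" and \<sigma>: "density_operator n \<sigma>"
  obtains c g :: "nat \<Rightarrow> real"
  where "\<And>k. k < n \<Longrightarrow> 0 \<le> c k"
    and "\<And>t. spec_fidelity t \<rho> \<sigma> = (\<Sum>k<n. c k * g k powr (2 * t))"
proof -
  have h: "hermitian_mat \<rho>" "hermitian_mat \<sigma>" "\<rho> \<in> carrier_mat n n" "\<sigma> \<in> carrier_mat n n"
    using \<rho> \<sigma> by (auto simp: density_operator_def psd_mat_def)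
  note i = mat_fun_carrier_hermitian[OF h(1,3), of "\<lambda>x. x powr (-1)", folded mat_rpow_def]
  note G = geo_mean_hermitian[OF i(2) h(2) i(1) h(4)]
  obtain U g where U: "U \<in> carrier_mat n n"
    and pow: "\<And>f. mat_fun f (geo_mean (mat_rpow \<rho> (-1)) \<sigma>) = unitary_conj_diag U (f \<circ> g)"
    using hermitian_mat_cases[OF G] by metis
  let ?c = "\<lambda>k. Re ((\<rho> *\<^sub>v col U k) \<bullet>c col U k)"
  show ?thesis
  proof (rule that[of ?c g])
    fix k assume "k < n"
    then have "col U k \<in> carrier_vec (dim_row \<rho>)" using U h(3) by auto
    with \<rho> have "0 \<le> (\<rho> *\<^sub>v col U k) \<bullet>c col U k"
      unfolding density_operator_def psd_mat_def by blast
    then show "0 \<le> ?c k" by (simp add: less_eq_complex_def)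
  next
    fix t
    show "spec_fidelity t \<rho> \<sigma> = (\<Sum>k<n. ?c k * g k powr (2 * t))"
      by (simp add: spec_fidelity_def mat_rpow_def[of "geo_mean _ _"] pow
          mat_trace_mult_unitary_conj_diag[OF h(3) U] mult.commute)
  qed
qed

theorem theorem5p2:
  fixes n :: nat and \<rho> \<sigma> :: "complex mat"
  assumes "density_operator n \<rho>" and "density_operator n \<sigma>"
  shows "(\<forall>s u \<theta> :: real. s < u \<and> \<theta> \<in> {0..1} \<longrightarrow>
            spec_fidelity ((1 - \<theta>) * s + \<theta> * u) \<rho> \<sigma>
              \<le> spec_fidelity s \<rho> \<sigma> powr (1 - \<theta>) * spec_fidelity u \<rho> \<sigma> powr \<theta>)
       \<and> log_convex_on UNIV (\<lambda>t. spec_fidelity t \<rho> \<sigma>)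
       \<and> log_convex_on {0..1} (\<lambda>t. spec_fidelity t \<rho> \<sigma>)"
proof -
  obtain c g :: "nat \<Rightarrow> real" where c: "\<And>k. k < n \<Longrightarrow> 0 \<le> c k"
    and F: "\<And>t. spec_fidelity t \<rho> \<sigma> = (\<Sum>k<n. c k * g k powr (2 * t))"
    using spec_fidelity_eq_powr_sum[OF assms] by metis
  have nonneg: "0 \<le> spec_fidelity t \<rho> \<sigma>" for t
    unfolding F by (intro sum_nonneg mult_nonneg_nonneg) (auto simp: c)
  have ineq: "spec_fidelity ((1 - \<theta>) * s + \<theta> * u) \<rho> \<sigma>
      \<le> spec_fidelity s \<rho> \<sigma> powr (1 - \<theta>) * spec_fidelity u \<rho> \<sigma> powr \<theta>"
    if "\<theta> \<in> {0..1}" for s u \<theta> :: real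
    using powr_sum_log_convex[of "{..<n}" \<theta> c g "2 * s" "2 * u"] c that
    by (simp add: F algebra_simps)
  have "log_convex_on S (\<lambda>t. spec_fidelity t \<rho> \<sigma>)" if "convex S" for S
    unfolding log_convex_on_def
    using that nonneg by (auto intro!: eln_weighted_le ineq)
  then show ?thesis using ineq by simp
qed

end
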